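(* Writing $f|_{q^s}$ for the coefficient of $q^s$ in a polynomial $f$: (1) For all $n\ge k\ge1$, $\overline{\mathbf{SF}}_{n,k}(q)|_{q^0}=\binom{n-1}{k-1}$. (2) For all $n>k\ge2$, $\overline{\mathbf{SF}}_{n,k}(q)|_{q}=(k-2)\binom{n-1}{k}$. (3) For all integers $s\ge0$ and $n\ge s$, $\overline{\mathbf{SF}}_{n,3}(q)|_{q^s}=\binom{n-1}{s+2}$. (4) For all $n\ge k\ge3$, $\overline{\mathbf{SF}}_{n,k}(q)|_{q^2}=(k-3)\binom{n-1}{k}+\binom{k-1}{2}\binom{n-1}{k+1}$. (5) For all $n\ge k\ge4$, $\overline{\mathbf{SF}}_{n,k}(q)|_{q^3}=(k-4)\binom{n-1}{k}+\left(\binom{k-1}{2}+\binom{k-2}{2}-1\right)\binom{n-1}{k+1}+\binom{k}{3}\binom{n-1}{k+2}$. (6) For all $n\ge k\ge4$, $$\overline{\mathbf{SF}}_{n,k}(q)|_{q^4}=(k-4)\binom{n-1}{k}+\left(\binom{k-1}{2}+\binom{k-2}{2}+\binom{k-3}{2}-3\right)\binom{n-1}{k+1}+\left(2\binom{k}{3}+\binom{k-1}{3}-k+1\right)\binom{n-1}{k+2}+\binom{k+1}{4}\binom{n-1}{k+3}.$$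
   Context: Fibonacci numbers: $F_0=0$, $F_1=1$, $F_m=F_{m-1}+F_{m-2}$. For any integer $m$, $[m]_q=\frac{1-q^m}{1-q}$. For $k\ge0$ let $\overline{[x]}_{\downarrow_{q,F,k}}=\prod_{i=0}^{k-1}([x]_q-[F_i]_q)$ (empty product $=1$). For $n\ge0$, $\overline{\mathbf{SF}}_{n,k}(q)$ ($0\le k\le n$) are the unique functions of $q$ (they are polynomials in $q$) with $[x]_q^n=\sum_{k=0}^n\overline{\mathbf{SF}}_{n,k}(q)\overline{[x]}_{\downarrow_{q,F,k}}$ for all positive integers $x$; $\overline{\mathbf{SF}}_{n,k}(q)=0$ if $k>n$. Binomial convention: $\binom{m}{j}=0$ whenever $m<j$ (including $m<0$). *)

theory Defs
  imports "HOL-Computational_Algebra.Computational_Algebra" "HOL-Number_Theory.Fib"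
begin

text \<open>
  Functions of \<open>q\<close> are elements of the field of rational functions \<open>\<rat>(q)\<close>, obtained as the
  fraction field of \<open>\<int>[q]\<close>, so that \<open>[m]\<^sub>q\<close> makes sense for every integer \<open>m\<close>.
\<close>

definition qvar :: "int poly fract" where
  "qvar = to_fract [:0, 1:]"

definition qint :: "int \<Rightarrow> int poly fract" where
  "qint m = (1 - qvar powi m) / (1 - qvar)"

definition qfib_falling :: "int \<Rightarrow> nat \<Rightarrow> int poly fract" where
  "qfib_falling x k = (\<Prod>i<k. qint x - qint (int (fib i)))"

definition is_SFbar_row :: "nat \<Rightarrow> (nat \<Rightarrow> int poly fract) \<Rightarrow> bool" where
  "is_SFbar_row n c \<longleftrightarrow>
     (\<forall>k>n. c k = 0) \<and> (\<forall>x>0. qint x ^ n = (\<Sum>k\<le>n. c k * qfib_falling x k))"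

text \<open>The description is proper by \<open>ex1_SFbar_row\<close> below.\<close>

definition SFbar :: "nat \<Rightarrow> nat \<Rightarrow> int poly fract" where
  "SFbar n = (THE c. is_SFbar_row n c)"

text \<open>
  Only meaningful if \<open>f\<close> is a polynomial in \<open>q\<close>; this holds for \<open>SFbar n k\<close> by
  \<open>SFbar_polynomial\<close> below.
\<close>

definition qcoeff :: "int poly fract \<Rightarrow> nat \<Rightarrow> int" where
  "qcoeff f s = coeff (THE p. f = to_fract p) s"

lemma qcoeff_to_fract [simp]: "qcoeff (to_fract p) s = coeff p s"
  by (simp add: qcoeff_def)

lemma to_fract_power: "to_fract (p ^ n) = to_fract p ^ n"
  by (induction n) auto

lemma qvar_neq_1: "qvar \<noteq> 1"
proof -
  have "[:0, 1:] \<noteq> (1 :: int poly)" by (simp add: one_pCons)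
  thus ?thesis unfolding qvar_def by (metis to_fract_1 to_fract_eq_iff)
qed

lemma qint_of_nat: "qint (int m) = to_fract (\<Sum>i<m. [:0, 1:] ^ i)"
proof -
  have "(1 - qvar) * (\<Sum>i<m. qvar ^ i) = 1 - qvar ^ m"
    by (rule one_diff_power_eq [symmetric])
  thus ?thesis using qvar_neq_1
    by (simp add: qint_def to_fract_sum to_fract_power qvar_def [symmetric] field_simps)
qed

lemma inj_qint_of_nat: "inj (\<lambda>m. qint (int m))"
proof (rule injI)
  fix m n :: nat
  assume "qint (int m) = qint (int n)"
  hence "qvar ^ m = qvar ^ n" using qvar_neq_1 by (simp add: qint_def)
  hence "[:0, 1:] ^ m = ([:0, 1:] ^ n :: int poly)"
    by (simp add: qvar_def to_fract_power [symmetric])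
  hence "degree ([:0, 1:] ^ m :: int poly) = degree ([:0, 1:] ^ n :: int poly)" by simp
  thus "m = n" by (simp add: degree_power_eq)
qed

lemma ex_polynomial_SFbar_row: "\<exists>c. is_SFbar_row n (\<lambda>k. to_fract (c k))"
proof (induction n)
  case 0
  show ?case
    by (rule exI [of _ "\<lambda>k. if k = 0 then 1 else 0"])
       (simp add: is_SFbar_row_def qfib_falling_def)
next
  case (Suc n)
  then obtain c where c0: "\<And>k. k > n \<Longrightarrow> c k = 0"
    and c: "\<And>x. x > 0 \<Longrightarrow> qint x ^ n = (\<Sum>k\<le>n. to_fract (c k) * qfib_falling x k)"
    by (auto simp: is_SFbar_row_def)
  define F where "F i = (\<Sum>j<fib i. [:0, 1:] ^ j :: int poly)" for i
  define d where "d k = (case k of 0 \<Rightarrow> 0 | Suc j \<Rightarrow> c j) + F k * c k" for k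
  have "qint x ^ Suc n = (\<Sum>k\<le>Suc n. to_fract (d k) * qfib_falling x k)" if "x > 0" for x
  proof -
    let ?f = "qfib_falling x"
    have step: "qint x * ?f k = ?f (Suc k) + to_fract (F k) * ?f k" for k
      unfolding F_def qint_of_nat [symmetric] by (simp add: qfib_falling_def algebra_simps)
    have "qint x ^ Suc n = (\<Sum>k\<le>n. to_fract (c k) * (qint x * ?f k))"
      using c [OF that] by (simp add: sum_distrib_left mult_ac)
    also have "\<dots> = (\<Sum>k\<le>n. to_fract (c k) * ?f (Suc k)) + (\<Sum>k\<le>n. to_fract (F k * c k) * ?f k)"
      unfolding step by (simp add: sum.distrib algebra_simps)
    also have "(\<Sum>k\<le>n. to_fract (F k * c k) * ?f k) = (\<Sum>k\<le>Suc n. to_fract (F k * c k) * ?f k)"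
      by (simp add: c0)
    also have "(\<Sum>k\<le>n. to_fract (c k) * ?f (Suc k)) =
        (\<Sum>k\<le>Suc n. to_fract (case k of 0 \<Rightarrow> 0 | Suc j \<Rightarrow> c j) * ?f k)"
      by (subst sum.atMost_Suc_shift) simp
    finally show ?thesis
      by (simp only: d_def to_fract_add sum.distrib [symmetric] distrib_right)
  qed
  moreover have "d k = 0" if "k > Suc n" for k
    using that by (auto simp: d_def c0 split: nat.splits)
  ultimately have "is_SFbar_row (Suc n) (\<lambda>k. to_fract (d k))"
    by (simp add: is_SFbar_row_def del: sum.atMost_Suc)
  thus ?case by blast
qed

lemma degree_prod_monic_linear:
  fixes a :: "nat \<Rightarrow> 'a :: idom"
  shows "degree (\<Prod>i<k. [:- a i, 1:]) = k" and "lead_coeff (\<Prod>i<k. [:- a i, 1:]) = 1"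
proof -
  show "degree (\<Prod>i<k. [:- a i, 1:]) = k"
    by (subst degree_prod_eq_sum_degree) auto
  show "lead_coeff (\<Prod>i<k. [:- a i, 1:]) = 1"
    by (simp add: lead_coeff_prod)
qed

lemma sum_monic_linear_eq_0:
  fixes a e :: "nat \<Rightarrow> 'a :: idom"
  assumes "(\<Sum>k\<le>n. smult (e k) (\<Prod>i<k. [:- a i, 1:])) = 0" and "k \<le> n"
  shows "e k = 0"
  using assms
proof (induction n)
  case 0
  thus ?case by simp
next
  case (Suc n)
  let ?B = "\<lambda>k. \<Prod>i<k. [:- a i, 1:]"
  have "coeff (?B k) (Suc n) = 0" if "k \<le> n" for k
    using that degree_prod_monic_linear(1) [of a k] by (intro coeff_eq_0) simp
  moreover have "coeff (?B (Suc n)) (Suc n) = 1"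
    using degree_prod_monic_linear [of a "Suc n"] by metis
  ultimately have "coeff (\<Sum>k\<le>Suc n. smult (e k) (?B k)) (Suc n) = e (Suc n)"
    by (simp add: coeff_sum del: prod.lessThan_Suc)
  hence e: "e (Suc n) = 0" using Suc.prems(1) by (metis coeff_0)
  show ?case
  proof (cases "k = Suc n")
    case False
    thus ?thesis using Suc e by simp
  qed (use e in simp)
qed

lemma SFbar_row_unique:
  assumes "is_SFbar_row n c" and "is_SFbar_row n d"
  shows "c = d"
proof
  fix k
  define P where
    "P = (\<Sum>k\<le>n. smult (c k - d k) (\<Prod>i<k. [:- qint (int (fib i)), 1:]))"
  have "poly P (qint (int m)) = 0" if "m > 0" for m
  proof -
    have "poly P (qint (int m)) = (\<Sum>k\<le>n. (c k - d k) * qfib_falling (int m) k)"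
      by (simp add: P_def poly_sum poly_prod qfib_falling_def)
    also have "\<dots> = qint (int m) ^ n - qint (int m) ^ n"
      using assms that by (simp add: is_SFbar_row_def sum_subtractf left_diff_distrib)
    finally show ?thesis by simp
  qed
  hence "(\<lambda>m. qint (int m)) ` {0<..} \<subseteq> {x. poly P x = 0}" by auto
  moreover have "infinite ((\<lambda>m. qint (int m)) ` {0<..})"
    using inj_qint_of_nat by (auto simp: finite_image_iff inj_on_subset infinite_Ioi)
  ultimately have "P = 0" using poly_roots_finite finite_subset by blast
  hence "c k - d k = 0" if "k \<le> n"
    using sum_monic_linear_eq_0 [of "\<lambda>k. c k - d k" _ n k] that unfolding P_def by simp
  thus "c k = d k" using assms by (cases "k \<le> n") (auto simp: is_SFbar_row_def)
qed

lemma ex1_SFbar_row: "\<exists>!c. is_SFbar_row n c"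
  using ex_polynomial_SFbar_row SFbar_row_unique by blast

lemma SFbar_row: "is_SFbar_row n (SFbar n)"
  unfolding SFbar_def by (rule theI' [OF ex1_SFbar_row])

lemma SFbar_polynomial: "\<exists>!p. SFbar n k = to_fract p"
proof -
  obtain c where "is_SFbar_row n (\<lambda>k. to_fract (c k))" using ex_polynomial_SFbar_row by blast
  hence "SFbar n = (\<lambda>k. to_fract (c k))" using SFbar_row SFbar_row_unique by blast
  thus ?thesis by auto
qed

end

theory Submission
  imports Defs
begin

text \<open>
  The numbers satisfy the triangular recurrence
  \<open>SF(n+1,k+1) = SF(n,k) + [F\<^bsub>k+1\<^esub>]\<^sub>q SF(n,k+1)\<close>. The coefficient of \<open>q\<^sup>s\<close> sees only
  the first \<open>s + 1\<close> terms of \<open>[F\<^bsub>k+1\<^esub>]\<^sub>q = 1 + q + q\<^sup>2 + \<dots>\<close>, so for \<open>s \<le> 4\<close> the Fibonacci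
  numbers matter only through \<open>F\<^sub>1 = F\<^sub>2 = 1\<close>, \<open>F\<^sub>3 = 2\<close>, \<open>F\<^sub>4 = 3\<close> and \<open>F\<^sub>k \<ge> 5\<close> for \<open>k \<ge> 5\<close>.
  Each formula then follows by induction on \<open>n\<close> from Pascal's rule, using the formulas for
  smaller \<open>s\<close>; it holds for \<open>1 \<le> n < k\<close> too, both sides being zero.
\<close>

section \<open>The explicit polynomials\<close>

fun SFpoly :: "nat \<Rightarrow> nat \<Rightarrow> int poly" where
  "SFpoly 0 k = (if k = 0 then 1 else 0)"
| "SFpoly (Suc n) 0 = 0"
| "SFpoly (Suc n) (Suc k) = SFpoly n k + (\<Sum>j<fib (Suc k). [:0, 1:] ^ j) * SFpoly n (Suc k)"

declare SFpoly.simps(3) [simp del]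

lemma SFpoly_eq_0: "k > n \<Longrightarrow> SFpoly n k = 0"
  by (induction n k rule: SFpoly.induct) (auto simp: SFpoly.simps(3))

text \<open>Multiplying the expansion of \<open>qint x ^ n\<close> by \<open>qint x\<close> and
  splitting \<open>qint x\<close> as \<open>(qint x - [F_k]_q) + [F_k]_q\<close> gives the
  recurrence: the first part lengthens the product, the second rescales it.\<close>

lemma is_SFbar_row_SFpoly: "is_SFbar_row n (\<lambda>k. to_fract (SFpoly n k))"
proof -
  have "qint x ^ n = (\<Sum>k\<le>n. to_fract (SFpoly n k) * qfib_falling x k)" for x
  proof (induction n)
    case 0
    show ?case by (simp add: qfib_falling_def)
  next
    case (Suc n)
    let ?f = "qfib_falling x" and ?c = "\<lambda>k. to_fract (SFpoly n k)"
    let ?F = "\<lambda>k. qint (int (fib k))"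
    have step: "qint x * ?f k = ?f (Suc k) + ?F k * ?f k" for k
      by (simp add: qfib_falling_def algebra_simps)
    \<comment> \<open>This removes the term of index 0, so that both sums run over
      \<open>Suc k\<close> and merge; it is also why \<open>SFpoly (Suc n) 0\<close> is 0.\<close>
    have F0: "?F 0 = 0" by (simp add: qint_def)
    have "qint x ^ Suc n = (\<Sum>k\<le>n. ?c k * (qint x * ?f k))"
      by (simp add: Suc sum_distrib_left mult_ac)
    also have "\<dots> = (\<Sum>k\<le>n. ?c k * ?f (Suc k)) + (\<Sum>k\<le>n. ?F k * ?c k * ?f k)"
      unfolding step by (simp add: sum.distrib algebra_simps)
    also have "(\<Sum>k\<le>n. ?F k * ?c k * ?f k) = (\<Sum>k\<le>Suc n. ?F k * ?c k * ?f k)"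
      by (simp add: SFpoly_eq_0)
    also have "\<dots> = (\<Sum>k\<le>n. ?F (Suc k) * ?c (Suc k) * ?f (Suc k))"
      unfolding sum.atMost_Suc_shift using F0 by simp
    also have "(\<Sum>k\<le>n. ?c k * ?f (Suc k)) + \<dots> =
        (\<Sum>k\<le>n. to_fract (SFpoly (Suc n) (Suc k)) * ?f (Suc k))"
      by (simp only: SFpoly.simps(3) qint_of_nat to_fract_add to_fract_mult
          sum.distrib [symmetric] distrib_right)
    also have "\<dots> = (\<Sum>k\<le>Suc n. to_fract (SFpoly (Suc n) k) * ?f k)"
      unfolding sum.atMost_Suc_shift by simp
    finally show ?case .
  qed
  thus ?thesis by (simp add: is_SFbar_row_def SFpoly_eq_0)
qed

section \<open>From rational functions to integer coefficients\<close>

lemma qcoeff_SFbar: "qcoeff (SFbar n k) s = coeff (SFpoly n k) s"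
  using SFbar_row_unique [OF SFbar_row is_SFbar_row_SFpoly, of n] by simp

text \<open>Multiplication by \<open>1 + q + ... + q^(m-1)\<close> sums a window of \<open>m\<close>
  consecutive coefficients, cut off below the constant term; the cut keeps the subtraction
  \<open>s - j\<close> exact.\<close>

lemma coeff_qint_mult:
  fixes p :: "int poly"
  shows "coeff ((\<Sum>j<m. [:0, 1:] ^ j) * p) s = (\<Sum>j<min m (Suc s). coeff p (s - j))"
proof -
  have "coeff ((\<Sum>j<m. [:0, 1:] ^ j) * p) s =
      (\<Sum>j<m. if j \<le> s then coeff p (s - j) else 0)"
    by (auto simp: sum_distrib_right coeff_sum coeff_monom_mult not_less
        simp flip: monom_altdef [of 1, simplified] intro!: sum.cong)
  also have "\<dots> = (\<Sum>j\<in>{j\<in>{..<m}. j \<le> s}. coeff p (s - j))"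
    by (intro sum.inter_filter [symmetric]) simp
  also have "{j\<in>{..<m}. j \<le> s} = {..<min m (Suc s)}" by auto
  finally show ?thesis .
qed

text \<open>The first argument is shifted, \<open>m = n - 1\<close>, matching the binomials \<open>n - 1 choose j\<close>.\<close>

definition sfc :: "nat \<Rightarrow> nat \<Rightarrow> nat \<Rightarrow> int" where
  "sfc m k s = coeff (SFpoly (Suc m) k) s"

lemma qcoeff_SFbar_sfc: "n > 0 \<Longrightarrow> qcoeff (SFbar n k) s = sfc (n - 1) k s"
  by (simp add: qcoeff_SFbar sfc_def)

lemma sfc_0_left: "sfc 0 k s = (if k = 1 \<and> s = 0 then 1 else 0)"
  by (cases k) (auto simp: sfc_def SFpoly.simps(3))

lemma sfc_0_mid [simp]: "sfc m 0 s = 0"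
  by (simp add: sfc_def)

lemma sfc_Suc:
  "sfc (Suc m) (Suc k) s = sfc m k s + (\<Sum>j<min (fib (Suc k)) (Suc s). sfc m (Suc k) (s - j))"
  by (simp add: sfc_def SFpoly.simps(3)[of "Suc m"] coeff_qint_mult)

lemma fib_ge_5: "k \<ge> 5 \<Longrightarrow> fib k \<ge> 5"
  using fib_mono [of 5 k] by (simp add: numeral_eq_Suc)

section \<open>Columns 1 to 3, for all powers of q\<close>

lemma sfc_1: "sfc m (Suc 0) s = (if s = 0 then 1 else 0)"
  by (induction m) (auto simp: sfc_0_left sfc_Suc)

lemma sfc_2: "sfc m 2 s = (if s = 0 then int m else 0)"
proof (induction m)
  case (Suc m)
  thus ?case using sfc_Suc [of m 1 s] by (simp add: sfc_1 numeral_2_eq_2)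
qed (simp add: sfc_0_left)

text \<open>As F_3 = 2, the window holds the powers \<open>s\<close> and \<open>s - 1\<close>, which
  gives Pascal's rule for \<open>s > 0\<close>. For \<open>s = 0\<close> column 2 supplies the
  missing term \<open>m choose 1\<close>.\<close>

lemma sfc_3: "sfc m 3 s = int (m choose (s + 2))"
proof (induction m arbitrary: s)
  case (Suc m)
  have "sfc (Suc m) 3 s = sfc m 2 s + (\<Sum>j<min 2 (Suc s). sfc m 3 (s - j))"
    using sfc_Suc [of m 2 s] by (simp add: numeral_eq_Suc)
  also have "\<dots> = int (Suc m choose (s + 2))"
    using sfc_2 [of m s] by (cases s) (simp_all add: Suc numeral_2_eq_2)
  finally show ?case .
qed (simp add: sfc_0_left)

section \<open>Coefficients of q^0 to q^4\<close>

lemma sfc_Suc_large: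
  assumes "k \<ge> 5" "s \<le> 4"
  shows "sfc (Suc m) k s = sfc m (k - 1) s + (\<Sum>j<Suc s. sfc m k (s - j))"
  using sfc_Suc [of m "k - 1" s] assms fib_ge_5 [of k] by (simp add: min_absorb2)

text \<open>As F_4 = 3, the window misses q^0 for \<open>s = 3\<close>, and q^0 and q^1 for
  \<open>s = 4\<close>; hence column 4 is treated separately below.\<close>

lemma sfc_Suc_4: "sfc (Suc m) 4 s = sfc m 3 s + (\<Sum>j<min 3 (Suc s). sfc m 4 (s - j))"
  using sfc_Suc [of m 3 s] by (simp add: numeral_eq_Suc)

lemma sfc_coeff_0: "sfc m (Suc k) 0 = int (m choose k)"
proof (induction m arbitrary: k)
  case 0
  thus ?case by (cases k) (simp_all add: sfc_0_left)
next
  case (Suc m)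
  have "min (fib (Suc k)) (Suc 0) = Suc 0"
    using fib_neq_0_nat [of "Suc k"] by simp
  thus ?case by (cases k) (simp_all add: sfc_Suc Suc)
qed

lemma sfc_coeff_1: "sfc m (k + 2) 1 = int k * int (m choose (k + 2))"
proof (induction m arbitrary: k)
  case (Suc m)
  show ?case
  proof (cases k)
    case (Suc i)
    have "fib (i + 3) \<ge> 2"
      using fib_mono [of 3 "i + 3"] by (simp add: numeral_eq_Suc)
    hence "sfc (Suc m) (k + 2) 1 = sfc m (i + 2) 1 + sfc m (k + 2) 1 + sfc m (k + 2) 0"
      using sfc_Suc [of m "i + 2" 1] Suc by (simp add: numeral_eq_Suc min_absorb2)
    \<comment> \<open>The constant term is \<open>m choose (k + 1)\<close>; it raises the factor
      \<open>i\<close> to \<open>k\<close>, and Pascal's rule applies.\<close>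
    thus ?thesis using Suc.IH sfc_coeff_0 [of m "Suc k"] Suc by (simp add: algebra_simps)
  qed (use sfc_2 [of "Suc m" 1] in \<open>simp add: numeral_2_eq_2\<close>)
qed (simp add: sfc_0_left)

lemma sfc_coeff_2:
  "sfc m (k + 3) 2 = int k * int (m choose (k + 3)) + int ((k + 2) choose 2) * int (m choose (k + 4))"
proof (induction m arbitrary: k)
  case (Suc m)
  show ?case
  proof (cases k)
    case (Suc i)
    have "fib (i + 4) \<ge> 3"
      using fib_mono [of 4 "i + 4"] by (simp add: numeral_eq_Suc)
    hence "sfc (Suc m) (k + 3) 2 =
        sfc m (i + 3) 2 + sfc m (k + 3) 2 + sfc m (k + 3) 1 + sfc m (k + 3) 0"
      using sfc_Suc [of m "i + 3" 2] Suc by (simp add: numeral_eq_Suc min_absorb2)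
    \<comment> \<open>Comparing the multiples of each binomial of \<open>m\<close> leaves
      \<open>(k+2 choose 2) = (k+1 choose 2) + (k+1)\<close>.\<close>
    thus ?thesis using Suc.IH sfc_coeff_0 [of m "k + 2"] sfc_coeff_1 [of m "k + 1"] Suc
      by (simp add: algebra_simps numeral_eq_Suc)
  qed (use sfc_3 [of "Suc m" 2] in \<open>simp add: numeral_eq_Suc\<close>)
qed (simp add: sfc_0_left binomial_eq_0)

lemma sfc_coeff_3:
  "sfc m (k + 4) 3 = int k * int (m choose (k + 4))
    + (int ((k + 3) choose 2) + int ((k + 2) choose 2) - 1) * int (m choose (k + 5))
    + int ((k + 4) choose 3) * int (m choose (k + 6))"
proof (induction m arbitrary: k)
  case (Suc m)
  show ?case
  proof (cases k)
    case 0
    \<comment> \<open>Without the constant term \<open>m choose 3\<close>, the leading factor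
      \<open>int k\<close> starts at 0 in column 4.\<close>
    have "sfc (Suc m) 4 3 = sfc m 3 3 + sfc m 4 3 + sfc m 4 2 + sfc m 4 1"
      using sfc_Suc_4 [of m 3] by (simp add: numeral_eq_Suc)
    thus ?thesis
      using Suc.IH [of 0] sfc_3 [of m 3] sfc_coeff_1 [of m 2] sfc_coeff_2 [of m 1] 0
      by (simp add: algebra_simps numeral_eq_Suc)
  next
    case (Suc i)
    have "sfc (Suc m) (k + 4) 3 =
        sfc m (i + 4) 3 + sfc m (k + 4) 3 + sfc m (k + 4) 2 + sfc m (k + 4) 1 + sfc m (k + 4) 0"
      using sfc_Suc_large [of "k + 4" 3 m] Suc by (simp add: eval_nat_numeral)
    \<comment> \<open>The factor of \<open>m choose (k + 5)\<close> grows by \<open>k + 1\<close>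
      and \<open>k + 2\<close>, one for each of its binomials; its \<open>- 1\<close> comes from the
      value 3 at \<open>k = 0\<close>.\<close>
    thus ?thesis
      using Suc.IH sfc_coeff_0 [of m "k + 3"] sfc_coeff_1 [of m "k + 2"]
        sfc_coeff_2 [of m "k + 1"] Suc
      by (simp add: algebra_simps numeral_eq_Suc)
  qed
qed (simp add: sfc_0_left binomial_eq_0)

lemma sfc_coeff_4:
  "sfc m (k + 4) 4 = int k * int (m choose (k + 4))
    + (int ((k + 3) choose 2) + int ((k + 2) choose 2) + int ((k + 1) choose 2) - 3)
        * int (m choose (k + 5))
    + (2 * int ((k + 4) choose 3) + int ((k + 3) choose 3) - int k - 3) * int (m choose (k + 6))
    + int ((k + 5) choose 4) * int (m choose (k + 7))"
proof (induction m arbitrary: k)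
  case (Suc m)
  show ?case
  proof (cases k)
    case 0
    have "sfc (Suc m) 4 4 = sfc m 3 4 + sfc m 4 4 + sfc m 4 3 + sfc m 4 2"
      using sfc_Suc_4 [of m 4] by (simp add: numeral_eq_Suc)
    thus ?thesis
      using Suc.IH [of 0] sfc_3 [of m 4] sfc_coeff_2 [of m 1] sfc_coeff_3 [of m 0] 0
      by (simp add: algebra_simps numeral_eq_Suc)
  next
    case (Suc i)
    have "sfc (Suc m) (k + 4) 4 =
        sfc m (i + 4) 4 + sfc m (k + 4) 4 + sfc m (k + 4) 3 + sfc m (k + 4) 2
          + sfc m (k + 4) 1 + sfc m (k + 4) 0"
      using sfc_Suc_large [of "k + 4" 4 m] Suc by (simp add: eval_nat_numeral)
    \<comment> \<open>The \<open>- int k\<close> in the third factor accumulates the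
      \<open>- 1\<close> of \<open>sfc_coeff_3\<close>, once per column.\<close>
    thus ?thesis
      using Suc.IH sfc_coeff_0 [of m "k + 3"] sfc_coeff_1 [of m "k + 2"] sfc_coeff_2 [of m "k + 1"]
        sfc_coeff_3 [of m k] Suc
      by (simp add: algebra_simps numeral_eq_Suc)
  qed
qed (simp add: sfc_0_left binomial_eq_0)

theorem theorem12:
  shows
    "(\<forall>n k :: nat. n \<ge> k \<and> k \<ge> 1 \<longrightarrow>
        qcoeff (SFbar n k) 0 = int ((n - 1) choose (k - 1)))
   \<and> (\<forall>n k :: nat. n > k \<and> k \<ge> 2 \<longrightarrow>
        qcoeff (SFbar n k) 1 = (int k - 2) * int ((n - 1) choose k))
   \<and> (\<forall>s n :: nat. n \<ge> s \<longrightarrow>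
        qcoeff (SFbar n 3) s = int ((n - 1) choose (s + 2)))
   \<and> (\<forall>n k :: nat. n \<ge> k \<and> k \<ge> 3 \<longrightarrow>
        qcoeff (SFbar n k) 2 =
          (int k - 3) * int ((n - 1) choose k)
          + int ((k - 1) choose 2) * int ((n - 1) choose (k + 1)))
   \<and> (\<forall>n k :: nat. n \<ge> k \<and> k \<ge> 4 \<longrightarrow>
        qcoeff (SFbar n k) 3 =
          (int k - 4) * int ((n - 1) choose k)
          + (int ((k - 1) choose 2) + int ((k - 2) choose 2) - 1) * int ((n - 1) choose (k + 1))
          + int (k choose 3) * int ((n - 1) choose (k + 2)))
   \<and> (\<forall>n k :: nat. n \<ge> k \<and> k \<ge> 4 \<longrightarrow>
        qcoeff (SFbar n k) 4 =
          (int k - 4) * int ((n - 1) choose k)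
          + (int ((k - 1) choose 2) + int ((k - 2) choose 2) + int ((k - 3) choose 2) - 3)
              * int ((n - 1) choose (k + 1))
          + (2 * int (k choose 3) + int ((k - 1) choose 3) - int k + 1)
              * int ((n - 1) choose (k + 2))
          + int ((k + 1) choose 4) * int ((n - 1) choose (k + 3)))"
proof (intro conjI allI impI; (elim conjE)?)
  fix n k :: nat
  assume "n \<ge> k" "k \<ge> 1"
  thus "qcoeff (SFbar n k) 0 = int ((n - 1) choose (k - 1))"
    using sfc_coeff_0 [of "n - 1" "k - 1"] by (simp add: qcoeff_SFbar_sfc)
next
  fix n k :: nat
  assume "n > k" "k \<ge> 2"
  moreover from \<open>k \<ge> 2\<close> obtain i where "k = i + 2" by (metis le_Suc_ex add.commute)
  ultimately show "qcoeff (SFbar n k) 1 = (int k - 2) * int ((n - 1) choose k)"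
    using sfc_coeff_1 [of "n - 1" i] by (simp add: qcoeff_SFbar_sfc)
next
  fix s n :: nat
  show "qcoeff (SFbar n 3) s = int ((n - 1) choose (s + 2))"
    \<comment> \<open>For \<open>n = 0\<close> the row is not covered by \<open>sfc\<close>;
      \<open>n - 1\<close> truncates to 0 and both sides are 0.\<close>
    by (cases n) (simp_all add: qcoeff_SFbar_sfc sfc_3 qcoeff_SFbar [of 0])
next
  fix n k :: nat
  assume "n \<ge> k" "k \<ge> 3"
  moreover from \<open>k \<ge> 3\<close> obtain i where "k = i + 3" by (metis le_Suc_ex add.commute)
  ultimately show "qcoeff (SFbar n k) 2 = (int k - 3) * int ((n - 1) choose k)
          + int ((k - 1) choose 2) * int ((n - 1) choose (k + 1))"
    using sfc_coeff_2 [of "n - 1" i] by (simp add: qcoeff_SFbar_sfc add.commute)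
next
  fix n k :: nat
  assume "n \<ge> k" "k \<ge> 4"
  moreover from \<open>k \<ge> 4\<close> obtain i where "k = i + 4" by (metis le_Suc_ex add.commute)
  ultimately show "qcoeff (SFbar n k) 3 = (int k - 4) * int ((n - 1) choose k)
          + (int ((k - 1) choose 2) + int ((k - 2) choose 2) - 1) * int ((n - 1) choose (k + 1))
          + int (k choose 3) * int ((n - 1) choose (k + 2))"
    using sfc_coeff_3 [of "n - 1" i] by (simp add: qcoeff_SFbar_sfc add.commute)
next
  fix n k :: nat
  assume "n \<ge> k" "k \<ge> 4"
  moreover from \<open>k \<ge> 4\<close> obtain i where "k = i + 4" by (metis le_Suc_ex add.commute)
  ultimately show "qcoeff (SFbar n k) 4 = (int k - 4) * int ((n - 1) choose k)
          + (int ((k - 1) choose 2) + int ((k - 2) choose 2) + int ((k - 3) choose 2) - 3)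
              * int ((n - 1) choose (k + 1))
          + (2 * int (k choose 3) + int ((k - 1) choose 3) - int k + 1)
              * int ((n - 1) choose (k + 2))
          + int ((k + 1) choose 4) * int ((n - 1) choose (k + 3))"
    using sfc_coeff_4 [of "n - 1" i] by (simp add: qcoeff_SFbar_sfc add.commute)
qed

end
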